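(* Let $\mathbb{T}^2=\mathbb{R}^2/\mathbb{Z}^2$. (1) There is an action by homeomorphisms of the free group on two generators on $X=\mathbb{T}^2\times\mathbb{Z}$ that is sensitive to initial conditions, but such that the pseudogroup generated by the action is not sensitive to initial conditions. (2) There is an action by homeomorphisms of the free group on countably (infinitely) many generators on $X=\mathbb{T}^2$ that is sensitive to initial conditions, but such that the pseudogroup generated by the action is not sensitive to initial conditions.
   Context: Metrics may take the value $\infty$; a metric on a topological space is compatible if its open balls generate the topology. $\mathbb Z$ is discrete. For sensitivity of group actions, $\mathbb{T}^2$ carries its standard flat metric, and $\mathbb{T}^2\times\mathbb{Z}$ carries a compatible metric restricting to the flat metric on each $\mathbb{T}^2\times\{z\}$. Sensitivity of a group action: an action $G\curvearrowright X$ by homeomorphisms on a metric space $(X,d)$ is sensitive to initial conditions if there is $c>0$ such that for every $x\in X$ and $r>0$ there are $y\in B(x,r)$ and $g\in G$ with $d(gx,gy)\ge c$. Pseudogroups: $\mathrm{Ph}(X)$ is the set of partial homeomorphisms of $X$, i.e. homeomorphisms $f\colon\mathrm{dom} f\to\mathrm{im} f$ between open subsets of $X$; the composition $gf$ has domain $f^{-1}(\mathrm{dom}\, g)$. A pseudo$*$group on $X$ is a subset of $\mathrm{Ph}(X)$ containing $\mathrm{id}_X$ and closed under inversion, composition and restriction to open subsets of domains. A pseudogroup on $X$ is a pseudo$*$group $\mathcal G$ that is also closed under combinations: if $f\in\mathrm{Ph}(X)$ and every $x\in\mathrm{dom} f$ has an open neighborhood $U_x$ with $f|_{U_x}\in\mathcal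 G$, then $f\in\mathcal G$. A subset $S\subset\mathcal G$ generates $\mathcal G$ if $\mathcal G$ is the smallest pseudogroup containing $S$. The pseudogroup generated by an action $G\curvearrowright X$ is the smallest pseudogroup containing all homeomorphisms $x\mapsto gx$, $g\in G$. Sensitivity of a pseudogroup: given a compatible metric $d$ on $X$ and a pseudo$*$group $\mathcal S\subset\mathcal G$ generating $\mathcal G$, $\mathcal G$ is $(\mathcal S,d)$-sensitive if there is $c>0$ such that for every $x\in X$ and $r>0$ there are $s\in\mathcal S$ and $y$ with $x,y\in\mathrm{dom}\, s$, $d(x,y)<r$ and $d(sx,sy)\ge c$. $\mathcal G$ is sensitive to initial conditions if it is $(\mathcal S,d)$-sensitive for every generating pseudo$*$group $\mathcal S$ and every compatible metric $d$. *)

theory Defs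
  imports "HOL-Analysis.Analysis" "HOL-Algebra.Group_Action"
begin

section \<open>The torus\<close>

quotient_type torus = "real \<times> real" / "\<lambda>p q. p - q \<in> \<int> \<times> \<int>"
proof (rule equivpI)
  show "reflp (\<lambda>p q :: real \<times> real. p - q \<in> \<int> \<times> \<int>)"
    by (auto simp: reflp_def zero_prod_def)
  show "symp (\<lambda>p q :: real \<times> real. p - q \<in> \<int> \<times> \<int>)"
  proof (rule sympI)
    fix p q :: "real \<times> real"
    assume "p - q \<in> \<int> \<times> \<int>"
    then have "- (p - q) \<in> \<int> \<times> \<int>"
      by (cases "p - q") (simp del: minus_diff_eq)
    then show "q - p \<in> \<int> \<times> \<int>" by simp
  qed
  show "transp (\<lambda>p q :: real \<times> real. p - q \<in> \<int> \<times> \<int>)"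
  proof (rule transpI)
    fix p q r :: "real \<times> real"
    assume a: "p - q \<in> \<int> \<times> \<int>" and b: "q - r \<in> \<int> \<times> \<int>"
    have "(p - q) + (q - r) \<in> \<int> \<times> \<int>"
      using a b by (cases "p - q"; cases "q - r") (simp del: add_diff_eq diff_add_cancel)
    then show "p - r \<in> \<int> \<times> \<int>" by simp
  qed
qed

lemma abs_torus_surj: "\<exists>p. abs_torus p = P"
  by (metis Quotient3_abs_rep Quotient3_torus)

lemma abs_torus_eq_iff: "abs_torus p = abs_torus q \<longleftrightarrow> p - q \<in> \<int> \<times> \<int>"
  using torus.abs_eq_iff by simp

lemma abs_torus_eq_near:
  assumes "abs_torus p = abs_torus q" "dist p q < 1"
  shows "p = q"
proof -
  have "fst p - fst q \<in> \<int>" "snd p - snd q \<in> \<int>"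
    using assms(1) by (auto simp: abs_torus_eq_iff mem_Times_iff)
  moreover have "\<bar>fst p - fst q\<bar> < 1" "\<bar>snd p - snd q\<bar> < 1"
    using assms(2) dist_fst_le[of p q] dist_snd_le[of p q] by (auto simp: dist_real_def)
  ultimately have "fst p - fst q = 0" "snd p - snd q = 0"
    using Ints_nonzero_abs_less1 by blast+
  then show ?thesis by (simp add: prod_eq_iff)
qed

text \<open>\<open>open\<close> is the quotient topology and \<open>dist\<close> the standard flat metric, that is, the quotient
  of the Euclidean metric of the plane. The instance proof shows that they are compatible.\<close>

instantiation torus :: metric_space
begin

definition open_torus :: "torus set \<Rightarrow> bool"
  where "open_torus U \<longleftrightarrow> open (abs_torus -` U)"

definition dist_torus :: "torus \<Rightarrow> torus \<Rightarrow> real"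
  where "dist_torus P Q = Inf {dist p q | p q. abs_torus p = P \<and> abs_torus q = Q}"

definition uniformity_torus :: "(torus \<times> torus) filter"
  where "uniformity_torus = (INF e\<in>{0<..}. principal {(P, Q). dist P Q < e})"

lemma dist_torus_le: "dist (abs_torus p) (abs_torus q) \<le> dist p q"
  unfolding dist_torus_def by (rule cInf_lower, blast) (auto intro!: bdd_belowI[of _ 0])

lemma dist_torus_lessE:
  assumes "dist (abs_torus p) Q < e"
  obtains q where "abs_torus q = Q" "dist p q < e"
proof -
  let ?S = "{dist p' q | p' q. abs_torus p' = abs_torus p \<and> abs_torus q = Q}"
  have "?S \<noteq> {}" using abs_torus_surj[of Q] by blast
  then obtain p' q' where pq: "abs_torus p' = abs_torus p" "abs_torus q' = Q" "dist p' q' < e"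
    using assms cInf_lessD[of ?S e] unfolding dist_torus_def by blast
  define q where "q = q' + (p - p')"
  have "abs_torus q = abs_torus q'"
    using pq(1)[symmetric] by (simp add: abs_torus_eq_iff q_def)
  moreover have "dist p q = dist p' q'"
    unfolding dist_norm q_def by (simp add: algebra_simps)
  ultimately show ?thesis using that pq by simp
qed

lemma open_torus_iff_dist: "open U \<longleftrightarrow> (\<forall>P\<in>U. \<exists>e>0. \<forall>Q. dist P Q < e \<longrightarrow> Q \<in> U)" for U :: "torus set"
proof
  assume U: "open U"
  show "\<forall>P\<in>U. \<exists>e>0. \<forall>Q. dist P Q < e \<longrightarrow> Q \<in> U"
  proof
    fix P assume P: "P \<in> U"
    obtain p where p: "abs_torus p = P" using abs_torus_surj by blast
    obtain e where e: "e > 0" "\<forall>q. dist q p < e \<longrightarrow> q \<in> abs_torus -` U"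
      using U P p unfolding open_torus_def open_dist by blast
    have "Q \<in> U" if "dist P Q < e" for Q
    proof -
      have "dist (abs_torus p) Q < e" using that p by simp
      then obtain q where "abs_torus q = Q" "dist q p < e"
        by (metis dist_commute dist_torus_lessE)
      then show ?thesis using e(2) by blast
    qed
    then show "\<exists>e>0. \<forall>Q. dist P Q < e \<longrightarrow> Q \<in> U" using e(1) by blast
  qed
next
  assume U: "\<forall>P\<in>U. \<exists>e>0. \<forall>Q. dist P Q < e \<longrightarrow> Q \<in> U"
  show "open U"
    unfolding open_torus_def open_dist
  proof
    fix p assume "p \<in> abs_torus -` U"
    then obtain e where "e > 0" "\<forall>Q. dist (abs_torus p) Q < e \<longrightarrow> Q \<in> U" using U by auto
    then show "\<exists>e>0. \<forall>q. dist q p < e \<longrightarrow> q \<in> abs_torus -` U"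
      by (metis dist_commute dist_torus_le le_less_trans vimageI2)
  qed
qed

instance
proof
  show uni: "uniformity = (INF e\<in>{0<..}. principal {(P, Q :: torus). dist P Q < e})"
    by (rule uniformity_torus_def)
  have ev: "eventually R uniformity \<longleftrightarrow> (\<exists>e>0. \<forall>P Q. dist P Q < e \<longrightarrow> R (P, Q))"
    for R :: "torus \<times> torus \<Rightarrow> bool"
    unfolding uni
  proof (subst eventually_INF_base)
    fix a b :: real
    assume "a \<in> {0<..}" "b \<in> {0<..}"
    then show "\<exists>e\<in>{0<..}. principal {(P, Q :: torus). dist P Q < e}
        \<le> inf (principal {(P, Q). dist P Q < a}) (principal {(P, Q). dist P Q < b})"
      by (intro bexI[of _ "min a b"]) auto
  qed (auto simp: eventually_principal)
  show "open U \<longleftrightarrow> (\<forall>P\<in>U. \<forall>\<^sub>F (P', Q) in uniformity. P' = P \<longrightarrow> Q \<in> U)" for U :: "torus set"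
    unfolding ev open_torus_iff_dist by auto
  show "dist P Q = 0 \<longleftrightarrow> P = Q" for P Q :: torus
  proof
    obtain p where p: "abs_torus p = P" using abs_torus_surj by blast
    {
      assume 0: "dist P Q = 0"
      have near: "\<exists>q. abs_torus q = Q \<and> dist p q < e" if "0 < e" for e
        using dist_torus_lessE[of p Q e] 0 p that by metis
      then obtain q where q: "abs_torus q = Q" "dist p q < 1/2"
        by (meson half_gt_zero zero_less_one)
      have small: "dist p q < e" if "0 < e" "e < 1/2" for e
      proof -
        obtain q' where q': "abs_torus q' = Q" "dist p q' < e"
          using near \<open>0 < e\<close> by blast
        have "dist q q' < 1"
          using dist_triangle3[of q q' p] q q' that by (auto simp: dist_commute)
        then show ?thesis using abs_torus_eq_near q q' by metis
      qed
      have "p = q"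
      proof (rule ccontr)
        assume "p \<noteq> q"
        then have "dist p q > 0" by simp
        then show False using small[of "min (1/4) (dist p q)"] by linarith
      qed
      then show "P = Q" using p q by simp
    }
    {
      assume "P = Q"
      then have "dist P Q \<le> 0" using p dist_torus_le[of p p] by simp
      moreover have "dist P Q \<ge> 0"
      proof -
        have "{dist p q | p q. abs_torus p = P \<and> abs_torus q = Q} \<noteq> {}"
          using abs_torus_surj[of P] abs_torus_surj[of Q] by blast
        then show ?thesis
          unfolding dist_torus_def by (rule cInf_greatest) auto
      qed
      ultimately show "dist P Q = 0" by simp
    }
  qed
  show "dist P Q \<le> dist P R + dist Q R" for P Q R :: torus
  proof (rule field_le_epsilon)
    fix e :: real assume "e > 0"
    have comm: "dist Q R = dist R Q"
      unfolding dist_torus_def by (metis dist_commute)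
    obtain p where p: "abs_torus p = P" using abs_torus_surj by blast
    have "dist (abs_torus p) R < dist P R + e/2" using p \<open>e > 0\<close> by simp
    then obtain r where r: "abs_torus r = R" "dist p r < dist P R + e/2"
      by (rule dist_torus_lessE)
    have "dist (abs_torus r) Q < dist R Q + e/2" using r \<open>e > 0\<close> by simp
    then obtain q where q: "abs_torus q = Q" "dist r q < dist R Q + e/2"
      by (rule dist_torus_lessE)
    have "dist P Q \<le> dist p q" using p q dist_torus_le by blast
    also have "\<dots> \<le> dist p r + dist r q" by (rule dist_triangle)
    finally show "dist P Q \<le> dist P R + dist Q R + e" using r q comm by simp
  qed
qed

end

section \<open>Free groups\<close>

text \<open>A letter is a generator with an exponent: \<open>(i, True)\<close> is the generator \<open>i\<close> and
  \<open>(i, False)\<close> its formal inverse. Elements of the free group are reduced words, and the product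
  of two reduced words is the reduced form of their concatenation.\<close>

definition inv_letter :: "'i \<times> bool \<Rightarrow> 'i \<times> bool"
  where "inv_letter x = (fst x, \<not> snd x)"

definition reduced_word :: "('i \<times> bool) list \<Rightarrow> bool"
  where "reduced_word w \<longleftrightarrow> successively (\<lambda>x y. y \<noteq> inv_letter x) w"

fun push_letter :: "'i \<times> bool \<Rightarrow> ('i \<times> bool) list \<Rightarrow> ('i \<times> bool) list"
  where
    "push_letter x [] = [x]"
  | "push_letter x (y # w) = (if y = inv_letter x then w else x # y # w)"

definition free_group :: "'i set \<Rightarrow> ('i \<times> bool) list monoid"
  where "free_group I =
    \<lparr>carrier = {w. reduced_word w \<and> fst ` set w \<subseteq> I},
     monoid.mult = (\<lambda>u v. foldr push_letter u v),
     one = []\<rparr>"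

lemma inv_letter_inv_letter [simp]: "inv_letter (inv_letter x) = x"
  by (simp add: inv_letter_def)

lemma fst_inv_letter [simp]: "fst (inv_letter x) = fst x"
  by (simp add: inv_letter_def)

lemma reduced_simps [simp]:
  "reduced_word []" "reduced_word [x]" "reduced_word (x # y # w) \<longleftrightarrow> y \<noteq> inv_letter x \<and> reduced_word (y # w)"
  by (simp_all add: reduced_word_def)

lemma reduced_ConsD: "reduced_word (x # w) \<Longrightarrow> reduced_word w"
  by (cases w) auto

lemma reduced_push_letter: "reduced_word w \<Longrightarrow> reduced_word (push_letter x w)"
  by (cases w) (auto dest: reduced_ConsD)

lemma set_push_letter: "set (push_letter x w) \<subseteq> insert x (set w)"
  by (cases w) auto

lemma push_letter_reduced: "reduced_word (x # w) \<Longrightarrow> push_letter x w = x # w"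
  by (cases w) auto

lemma push_letter_cancel: "reduced_word w \<Longrightarrow> push_letter x (push_letter (inv_letter x) w) = w"
  by (cases w) (auto simp: push_letter_reduced)

lemma reduced_foldr: "reduced_word v \<Longrightarrow> reduced_word (foldr push_letter u v)"
  by (induction u) (auto simp: reduced_push_letter)

lemma set_foldr: "set (foldr push_letter u v) \<subseteq> set u \<union> set v"
  using set_push_letter by (induction u) fastforce+

lemma foldr_push_letter:
  assumes "reduced_word u" "reduced_word v"
  shows "foldr push_letter (push_letter x u) v = push_letter x (foldr push_letter u v)"
proof (cases u)
  case (Cons y w)
  have "foldr push_letter w v = push_letter x (push_letter (inv_letter x) (foldr push_letter w v))"
    using assms by (simp add: push_letter_cancel reduced_foldr)
  then show ?thesis using Cons by auto
qed simp

lemma push_foldr_assoc: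
  assumes "reduced_word u" "reduced_word v" "reduced_word w"
  shows "foldr push_letter (foldr push_letter u v) w = foldr push_letter u (foldr push_letter v w)"
  using assms
  by (induction u) (auto simp: foldr_push_letter reduced_foldr dest: reduced_ConsD)

lemma push_foldr_Nil: "reduced_word u \<Longrightarrow> foldr push_letter u [] = u"
  proof (induction u)
  case (Cons x u)
  then show ?case using push_letter_reduced[of x u] reduced_ConsD[of x u] by simp
qed simp

lemma foldr_left_inverse:
  "reduced_word v \<Longrightarrow> foldr push_letter (rev (map inv_letter u)) (foldr push_letter u v) = v"
proof (induction u)
  case (Cons x u)
  then show ?case
    using push_letter_cancel[of "foldr push_letter u v" "inv_letter x"] by (simp add: reduced_foldr)
qed simp

lemma free_group_is_group: "group (free_group I)"
proof (rule groupI)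
  fix u v assume "u \<in> carrier (free_group I)" "v \<in> carrier (free_group I)"
  then show "u \<otimes>\<^bsub>free_group I\<^esub> v \<in> carrier (free_group I)"
    using set_foldr[of u v] image_mono[OF set_foldr[of u v], of fst]
    by (simp add: free_group_def reduced_foldr image_Un) blast
next
  fix u assume u: "u \<in> carrier (free_group I)"
  define v where "v = foldr push_letter (rev (map inv_letter u)) []"
  have "reduced_word v" by (simp add: v_def reduced_foldr)
  moreover have "set v \<subseteq> inv_letter ` set u"
    using set_foldr[of "rev (map inv_letter u)" "[]"] by (simp add: v_def)
  ultimately have "v \<in> carrier (free_group I)"
    using u by (fastforce simp: free_group_def)
  moreover have "foldr push_letter v u = []"
  proof -
    have "foldr push_letter v u = foldr push_letter (rev (map inv_letter u)) (foldr push_letter u [])"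
      if r: "reduced_word u"
    proof -
      have "foldr push_letter (foldr push_letter a []) u = foldr push_letter a u" for a
        by (induction a) (simp_all add: foldr_push_letter reduced_foldr r)
      then show ?thesis by (simp add: v_def push_foldr_Nil r)
    qed
    then show ?thesis using u foldr_left_inverse[of "[]" u] by (simp add: free_group_def)
  qed
  ultimately show "\<exists>v\<in>carrier (free_group I). v \<otimes>\<^bsub>free_group I\<^esub> u = \<one>\<^bsub>free_group I\<^esub>"
    by (auto simp: free_group_def)
qed (simp_all add: free_group_def push_foldr_assoc)

section \<open>Compatible metrics and sensitive group actions\<close>

definition extended_metric :: "('a \<Rightarrow> 'a \<Rightarrow> ennreal) \<Rightarrow> bool"
  where "extended_metric d \<longleftrightarrow>
    (\<forall>x y. d x y = 0 \<longleftrightarrow> x = y) \<and> (\<forall>x y. d x y = d y x) \<and> (\<forall>x y z. d x z \<le> d x y + d y z)"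

definition compatible_metric :: "('a::topological_space \<Rightarrow> 'a \<Rightarrow> ennreal) \<Rightarrow> bool"
  where "compatible_metric d \<longleftrightarrow>
    extended_metric d \<and> open = generate_topology {{y. d x y < ennreal r} | x r. r > 0}"

definition action_by_homeos ::
    "('g, 'm) monoid_scheme \<Rightarrow> ('g \<Rightarrow> 'a::topological_space \<Rightarrow> 'a) \<Rightarrow> bool"
  where "action_by_homeos G \<phi> \<longleftrightarrow>
    group_action G UNIV \<phi> \<and> (\<forall>g\<in>carrier G. \<exists>h. homeomorphism UNIV UNIV (\<phi> g) h)"

definition action_sensitive ::
    "('g, 'm) monoid_scheme \<Rightarrow> ('g \<Rightarrow> 'a \<Rightarrow> 'a) \<Rightarrow> ('a \<Rightarrow> 'a \<Rightarrow> ennreal) \<Rightarrow> bool"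
  where "action_sensitive G \<phi> d \<longleftrightarrow>
    (\<exists>c::real. c > 0 \<and> (\<forall>x. \<forall>r::real. r > 0 \<longrightarrow>
      (\<exists>y. d x y < ennreal r \<and> (\<exists>g\<in>carrier G. d (\<phi> g x) (\<phi> g y) \<ge> ennreal c))))"

text \<open>The metrics on the product of the torus with the integers that are used for sensitivity of
  actions. The distance between different fibres is not prescribed.\<close>

definition flat_on_fibres :: "(torus \<times> int \<Rightarrow> torus \<times> int \<Rightarrow> ennreal) \<Rightarrow> bool"
  where "flat_on_fibres d \<longleftrightarrow> (\<forall>z P Q. d (P, z) (Q, z) = ennreal (dist P Q))"

lemma ex_compatible_flat_on_fibres: "\<exists>d. compatible_metric d \<and> flat_on_fibres d"
proof -
  define d :: "torus \<times> int \<Rightarrow> torus \<times> int \<Rightarrow> ennreal"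
    where "d x y = (if snd x = snd y then ennreal (dist (fst x) (fst y)) else \<infinity>)" for x y
  have "extended_metric d"
    unfolding extended_metric_def
  proof (intro conjI allI)
    show "d x z \<le> d x y + d y z" for x y z
      using dist_triangle[of "fst x" "fst z" "fst y"]
      by (auto simp: d_def simp flip: ennreal_plus intro: ennreal_leI)
  qed (auto simp: d_def prod_eq_iff dist_commute)
  moreover have "open = generate_topology {{y. d x y < ennreal r} | x r. r > 0}"
    (is "_ = generate_topology ?B")
  proof (intro ext iffI)
    have ball: "{y. d x y < ennreal r} = ball (fst x) r \<times> {snd x}" if "r > 0" for x r
      using that by (auto simp: d_def ennreal_less_iff)
    fix U :: "(torus \<times> int) set"
    {
      assume U: "open U"
      have "\<exists>r>0. {y. d x y < ennreal r} \<subseteq> U" if "x \<in> U" for x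
      proof -
        obtain A B where AB: "open A" "open B" "x \<in> A \<times> B" "A \<times> B \<subseteq> U"
          using U \<open>x \<in> U\<close> by (auto elim: open_prod_elim simp del: split_paired_All)
        then obtain r where "r > 0" "ball (fst x) r \<subseteq> A"
          by (auto simp: open_contains_ball mem_Times_iff)
        then show ?thesis using AB ball[of r x] by (intro exI[of _ r]) auto
      qed
      then obtain r where r: "\<And>x. x \<in> U \<Longrightarrow> r x > 0 \<and> {y. d x y < ennreal (r x)} \<subseteq> U"
        by metis
      then have "U = (\<Union>x\<in>U. {y. d x y < ennreal (r x)})"
        by (fastforce simp: d_def)
      moreover have "generate_topology ?B (\<Union>x\<in>U. {y. d x y < ennreal (r x)})"
        using r by (intro generate_topology_Union generate_topology.Basis) blast
      ultimately show "generate_topology ?B U" by simp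
    }
    {
      assume "generate_topology ?B U"
      then show "open U"
      proof induction
        case (Basis s)
        then obtain x r where "r > 0" "s = {y. d x y < ennreal r}" by blast
        then show ?case by (simp add: ball open_Times open_discrete)
      qed auto
    }
  qed
  ultimately show ?thesis
    unfolding compatible_metric_def flat_on_fibres_def by (intro exI[of _ d]) (auto simp: d_def)
qed

section \<open>Pseudogroups\<close>

text \<open>A partial homeomorphism is a map \<open>f :: 'a \<rightharpoonup> 'a\<close> with open domain \<open>dom f\<close> and open image
  \<open>ran f\<close>. With this encoding \<open>Some\<close> is the identity, \<open>g \<circ>\<^sub>m f\<close> is the composition with domain
  the preimage of \<open>dom g\<close> under \<open>f\<close>, and \<open>f |` U\<close> is the restriction to \<open>U\<close>.\<close>

definition partial_homeos :: "('a::topological_space \<rightharpoonup> 'a) set"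
  where "partial_homeos =
    {f. open (dom f) \<and> open (ran f) \<and> (\<exists>g. homeomorphism (dom f) (ran f) (\<lambda>x. the (f x)) g)}"

definition map_inv :: "('a \<rightharpoonup> 'a) \<Rightarrow> ('a \<rightharpoonup> 'a)"
  where "map_inv f = (\<lambda>y. if y \<in> ran f then Some (THE x. f x = Some y) else None)"

definition pseudo_star_group :: "('a::topological_space \<rightharpoonup> 'a) set \<Rightarrow> bool"
  where "pseudo_star_group \<S> \<longleftrightarrow>
    \<S> \<subseteq> partial_homeos \<and>
    Some \<in> \<S> \<and>
    (\<forall>f\<in>\<S>. map_inv f \<in> \<S>) \<and>
    (\<forall>g\<in>\<S>. \<forall>f\<in>\<S>. g \<circ>\<^sub>m f \<in> \<S>) \<and>
    (\<forall>f\<in>\<S>. \<forall>U. open U \<and> U \<subseteq> dom f \<longrightarrow> f |` U \<in> \<S>)"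

definition pseudogroup :: "('a::topological_space \<rightharpoonup> 'a) set \<Rightarrow> bool"
  where "pseudogroup \<G> \<longleftrightarrow>
    pseudo_star_group \<G> \<and>
    (\<forall>f\<in>partial_homeos.
      (\<forall>x\<in>dom f. \<exists>U. open U \<and> x \<in> U \<and> U \<subseteq> dom f \<and> f |` U \<in> \<G>) \<longrightarrow> f \<in> \<G>)"

definition generates_pseudogroup ::
    "('a::topological_space \<rightharpoonup> 'a) set \<Rightarrow> ('a \<rightharpoonup> 'a) set \<Rightarrow> bool"
  where "generates_pseudogroup \<S> \<G> \<longleftrightarrow>
    pseudogroup \<G> \<and> \<S> \<subseteq> \<G> \<and> (\<forall>\<H>. pseudogroup \<H> \<and> \<S> \<subseteq> \<H> \<longrightarrow> \<G> \<subseteq> \<H>)"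

definition action_homeos :: "('g, 'm) monoid_scheme \<Rightarrow> ('g \<Rightarrow> 'a \<Rightarrow> 'a) \<Rightarrow> ('a \<rightharpoonup> 'a) set"
  where "action_homeos G \<phi> = {(\<lambda>x. Some (\<phi> g x)) | g. g \<in> carrier G}"

definition sensitive_wrt ::
    "('a \<rightharpoonup> 'a) set \<Rightarrow> ('a \<Rightarrow> 'a \<Rightarrow> ennreal) \<Rightarrow> bool"
  where "sensitive_wrt \<S> d \<longleftrightarrow>
    (\<exists>c::real. c > 0 \<and> (\<forall>x. \<forall>r::real. r > 0 \<longrightarrow>
      (\<exists>s\<in>\<S>. \<exists>y. x \<in> dom s \<and> y \<in> dom s \<and> d x y < ennreal r \<and>
        d (the (s x)) (the (s y)) \<ge> ennreal c)))"

definition pseudogroup_sensitive :: "('a::topological_space \<rightharpoonup> 'a) set \<Rightarrow> bool"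
  where "pseudogroup_sensitive \<G> \<longleftrightarrow>
    (\<forall>\<S> d. pseudo_star_group \<S> \<and> \<S> \<subseteq> \<G> \<and> generates_pseudogroup \<S> \<G> \<and> compatible_metric d
      \<longrightarrow> sensitive_wrt \<S> d)"

end

theory Submission
  imports Defs
begin

text \<open>
  Both actions are by shears of the torus. Write \<open>\<parallel>y\<parallel>\<close> for the distance of \<open>y\<close> to the nearest
  integer; the height of a point \<open>(x, y)\<close> of the torus is \<open>\<parallel>y\<parallel>\<close>. For a continuous function \<open>H\<close> of
  the height, the map \<open>(x, y) \<mapsto> (x + H \<parallel>y\<parallel>, y)\<close> is a homeomorphism of the torus, it preserves the
  height, and composing two such maps adds the functions. So any family \<open>h\<close> of continuous functions
  makes a free group act, with the generator \<open>i\<close> acting by the shear along \<open>h i\<close>.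

  \<^bold>\<open>Sensitivity of the action.\<close> Two points at slightly different heights \<open>s\<close> and \<open>t\<close> are displaced
  relative to each other by \<open>m (h i s - h i t)\<close> under the \<open>m\<close>-th power of the generator \<open>i\<close>. If
  this difference is a nonzero number of absolute value at most \<open>1/2\<close>, then some \<open>m\<close> brings the
  multiple to distance at least \<open>1/4\<close> from the integers. Since the height is not locally constant,
  it suffices that the functions \<open>h i\<close> separate heights (\<open>shear_action_expands\<close>).

  \<^bold>\<open>Non-sensitivity of the pseudogroup.\<close> A pseudogroup remembers only germs, so a generating
  pseudo*group may consist of small pieces of its elements, and how small may depend on the place.
  Suppose that there are nonempty open sets \<open>B n\<close>, each invariant under the action, and that every
  group element is, locally, the identity on all but finitely many of them. Let \<open>\<S>\<close> consist of those
  elements of the pseudogroup that on each \<open>B n\<close> either are the identity or have domain and image of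
  diameter at most \<open>1/(n + 1)\<close>. By finiteness, every group element restricts to an element of \<open>\<S>\<close>
  near every point, so \<open>\<S>\<close> generates; but at a point of \<open>B n\<close> no element of \<open>\<S>\<close> spreads a small
  ball to more than \<open>1/(n + 1)\<close>, so no constant of sensitivity exists for \<open>\<S>\<close>
  (\<open>action_pseudogroup_not_sensitive\<close>).

  On the product of the torus with \<open>\<int>\<close> the sets \<open>B n\<close> are fibres, so one shear with \<open>H t = t\<close> on every fibre is enough. On the
  torus itself, which is compact, infinitely many generators are used: with
  \<open>h i t = max 0 (t - 1/(i + 1))\<close> and \<open>B n\<close> the points of height below \<open>1/(n + 1)\<close>, the generator \<open>i\<close> is
  the identity on \<open>B n\<close> for all \<open>n \<ge> i\<close>.
\<close>

section \<open>Partial homeomorphisms\<close>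

text \<open>Partial homeomorphisms described by images and preimages of open sets, with no inverse map to
  carry along: in this form the closure properties below are set identities, and the two topological
  conditions exchange under inversion.\<close>

lemma partial_homeos_iff:
  "f \<in> partial_homeos \<longleftrightarrow>
    (\<forall>x x' y. f x = Some y \<and> f x' = Some y \<longrightarrow> x = x') \<and>
    (\<forall>V. open V \<longrightarrow> open {x. \<exists>y\<in>V. f x = Some y}) \<and>
    (\<forall>U. open U \<longrightarrow> open {y. \<exists>x\<in>U. f x = Some y})" (is "_ \<longleftrightarrow> ?inj \<and> ?cont \<and> ?open")
proof
  assume "f \<in> partial_homeos"
  then obtain g where op: "open (dom f)" "open (ran f)"
    and hom: "homeomorphism (dom f) (ran f) (\<lambda>x. the (f x)) g"
    by (auto simp: partial_homeos_def)
  have gf: "g y = x" if "f x = Some y" for x y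
    using hom that unfolding homeomorphism_def by (metis domI option.sel)
  have fg: "f (g y) = Some y" if "y \<in> ran f" for y
    using gf that by (auto simp: ran_def)
  have ?inj using gf by blast
  moreover have ?cont
  proof (intro allI impI)
    fix V :: "'a set" assume "open V"
    moreover have "{x. \<exists>y\<in>V. f x = Some y} = (\<lambda>x. the (f x)) -` V \<inter> dom f" by force
    ultimately show "open {x. \<exists>y\<in>V. f x = Some y}"
      using hom op by (simp add: continuous_on_open_vimage homeomorphism_def)
  qed
  moreover have ?open
  proof (intro allI impI)
    fix U :: "'a set" assume "open U"
    moreover have "{y. \<exists>x\<in>U. f x = Some y} = g -` U \<inter> ran f"
      using gf fg by (auto intro: ranI)
    ultimately show "open {y. \<exists>x\<in>U. f x = Some y}"
      using hom op by (simp add: continuous_on_open_vimage homeomorphism_def)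
  qed
  ultimately show "?inj \<and> ?cont \<and> ?open" by blast
next
  assume *: "?inj \<and> ?cont \<and> ?open"
  have dom_ran: "{x. \<exists>y\<in>UNIV. f x = Some y} = dom f" "{y. \<exists>x\<in>UNIV. f x = Some y} = ran f"
    by (auto simp: ran_def)
  have op: "open (dom f)" "open (ran f)"
    unfolding dom_ran[symmetric] using * open_UNIV by blast+
  define g where "g y = (SOME x. f x = Some y)" for y
  have gf: "g y = x" if "f x = Some y" for x y
    unfolding g_def using * that by (metis (mono_tags, lifting) someI)
  have fg: "f (g y) = Some y" if "y \<in> ran f" for y
    using gf that by (auto simp: ran_def)
  have "homeomorphism (dom f) (ran f) (\<lambda>x. the (f x)) g"
    unfolding homeomorphism_def
  proof (intro conjI ballI)
    show "(\<lambda>x. the (f x)) ` dom f = ran f" by (force simp: ran_def)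
    show "g ` ran f = dom f" using gf fg by (force simp: ran_def)
    have "(\<lambda>x. the (f x)) -` V \<inter> dom f = {x. \<exists>y\<in>V. f x = Some y}" for V by force
    then show "continuous_on (dom f) (\<lambda>x. the (f x))"
      using * op by (simp add: continuous_on_open_vimage)
    have "g -` U \<inter> ran f = {y. \<exists>x\<in>U. f x = Some y}" for U
      using gf fg by (auto intro: ranI)
    then show "continuous_on (ran f) g"
      using * op by (simp add: continuous_on_open_vimage)
  qed (use gf fg in auto)
  then show "f \<in> partial_homeos"
    using op by (auto simp: partial_homeos_def)
qed

lemma partial_homeos_inj:
  "f \<in> partial_homeos \<Longrightarrow> f x = Some y \<Longrightarrow> f x' = Some y \<Longrightarrow> x = x'"
  by (auto simp: partial_homeos_iff)

lemma map_inv_eq_Some_iff: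
  assumes "f \<in> partial_homeos"
  shows "map_inv f y = Some x \<longleftrightarrow> f x = Some y"
proof -
  have "(THE x. f x = Some y) = x" if "f x = Some y" for x
    using that partial_homeos_inj[OF assms] by (intro the_equality) auto
  then show ?thesis
    unfolding map_inv_def ran_def by (cases "\<exists>a. f a = Some y") auto
qed

lemma map_comp_eq_Some_iff: "(g \<circ>\<^sub>m f) x = Some z \<longleftrightarrow> (\<exists>y. f x = Some y \<and> g y = Some z)"
  by (auto simp: map_comp_def split: option.splits)

lemma restrict_map_eq_Some_iff: "(f |` U) x = Some y \<longleftrightarrow> x \<in> U \<and> f x = Some y"
  by (auto simp: restrict_map_def)

lemma pseudo_star_group_partial_homeos: "pseudo_star_group partial_homeos"
  unfolding pseudo_star_group_def
proof (intro conjI ballI allI impI)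
  show "Some \<in> partial_homeos" by (simp add: partial_homeos_iff)
next
  fix f :: "'a \<rightharpoonup> 'a" assume f: "f \<in> partial_homeos"
  then show "map_inv f \<in> partial_homeos"
    unfolding partial_homeos_iff[of "map_inv f"] map_inv_eq_Some_iff[OF f]
    by (auto simp: partial_homeos_iff)
next
  fix f g :: "'a \<rightharpoonup> 'a" assume f: "f \<in> partial_homeos" and g: "g \<in> partial_homeos"
  have "{x. \<exists>z\<in>V. (g \<circ>\<^sub>m f) x = Some z} = {x. \<exists>y\<in>{y. \<exists>z\<in>V. g y = Some z}. f x = Some y}"
    and "{z. \<exists>x\<in>V. (g \<circ>\<^sub>m f) x = Some z} = {z. \<exists>y\<in>{y. \<exists>x\<in>V. f x = Some y}. g y = Some z}" for V
    by (auto simp: map_comp_eq_Some_iff)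
  then show "g \<circ>\<^sub>m f \<in> partial_homeos"
    using f g unfolding partial_homeos_iff by (auto simp: map_comp_eq_Some_iff)
next
  fix f :: "'a \<rightharpoonup> 'a" and U assume f: "f \<in> partial_homeos" and U: "open U \<and> U \<subseteq> dom f"
  have "{x. \<exists>y\<in>V. (f |` U) x = Some y} = {x. \<exists>y\<in>V. f x = Some y} \<inter> U"
    and "{y. \<exists>x\<in>V. (f |` U) x = Some y} = {y. \<exists>x\<in>V \<inter> U. f x = Some y}" for V
    by (auto simp: restrict_map_eq_Some_iff)
  then show "f |` U \<in> partial_homeos"
    using f U unfolding partial_homeos_iff
    by (auto simp: restrict_map_eq_Some_iff intro: open_Int)
qed simp

text \<open>The generated pseudogroup is the intersection of all pseudogroups containing \<open>A\<close>; the set of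
  all partial homeomorphisms is one of them, so the intersection is over a nonempty family.\<close>

lemma generated_pseudogroup_exists:
  assumes "A \<subseteq> partial_homeos"
  shows "\<exists>\<G>. generates_pseudogroup A \<G>"
proof
  let ?P = "{\<H>. pseudogroup \<H> \<and> A \<subseteq> \<H>}"
  have top: "partial_homeos \<in> ?P"
    using assms pseudo_star_group_partial_homeos by (auto simp: pseudogroup_def)
  have star: "pseudo_star_group \<H>" if "\<H> \<in> ?P" for \<H>
    using that by (simp add: pseudogroup_def)
  have "pseudo_star_group (\<Inter>?P)"
    unfolding pseudo_star_group_def
  proof (intro conjI ballI allI impI InterI)
    show "\<Inter>?P \<subseteq> partial_homeos" by (rule Inter_lower[OF top])
  next
    fix \<H> assume "\<H> \<in> ?P"
    then show "Some \<in> \<H>" using star by (simp add: pseudo_star_group_def)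
  next
    fix f \<H> assume "f \<in> \<Inter>?P" and \<H>: "\<H> \<in> ?P"
    then have "f \<in> \<H>" by (meson InterD)
    then show "map_inv f \<in> \<H>" using star[OF \<H>] by (simp add: pseudo_star_group_def)
  next
    fix f g \<H> assume "g \<in> \<Inter>?P" "f \<in> \<Inter>?P" and \<H>: "\<H> \<in> ?P"
    then have "g \<in> \<H>" "f \<in> \<H>" by (meson InterD)+
    then show "g \<circ>\<^sub>m f \<in> \<H>" using star[OF \<H>] by (simp add: pseudo_star_group_def)
  next
    fix f U \<H> assume "f \<in> \<Inter>?P" and U: "open U \<and> U \<subseteq> dom f" and \<H>: "\<H> \<in> ?P"
    then have "f \<in> \<H>" by (meson InterD)
    then show "f |` U \<in> \<H>" using star[OF \<H>] U by (simp add: pseudo_star_group_def)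
  qed
  moreover have "f \<in> \<Inter>?P" if f: "f \<in> partial_homeos"
    and loc: "\<forall>x\<in>dom f. \<exists>U. open U \<and> x \<in> U \<and> U \<subseteq> dom f \<and> f |` U \<in> \<Inter>?P" for f
  proof
    fix \<H> assume \<H>: "\<H> \<in> ?P"
    have "\<Inter>?P \<subseteq> \<H>" using \<H> by (rule Inter_lower)
    then have "\<forall>x\<in>dom f. \<exists>U. open U \<and> x \<in> U \<and> U \<subseteq> dom f \<and> f |` U \<in> \<H>"
      using loc by (meson subsetD)
    then show "f \<in> \<H>" using \<H> f by (simp add: pseudogroup_def)
  qed
  ultimately have "pseudogroup (\<Inter>?P)" by (simp add: pseudogroup_def)
  then show "generates_pseudogroup A (\<Inter>?P)"
    by (auto simp: generates_pseudogroup_def)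
qed

section \<open>Compatible metrics\<close>

lemma compatible_metric_open_ball:
  assumes "compatible_metric d" "r > 0"
  shows "open {y. d x y < ennreal r}"
proof -
  have top: "open = generate_topology {{y. d x y < ennreal r} | x r. r > 0}"
    using assms by (simp add: compatible_metric_def)
  show ?thesis
    unfolding top by (rule generate_topology.Basis) (use \<open>r > 0\<close> in blast)
qed

text \<open>Compatibility only makes the balls a subbase. By the triangle inequality they are a base, even
  the balls centred at the given point.\<close>

lemma compatible_metric_ball_subset:
  assumes d: "compatible_metric d" and "open U" "x \<in> U"
  shows "\<exists>r>0. {y. d x y < ennreal r} \<subseteq> U"
proof -
  let ?B = "{{y. d x y < ennreal r} | x r. r > 0}"
  have ext: "extended_metric d" and "generate_topology ?B U"
    using d \<open>open U\<close> by (auto simp: compatible_metric_def)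
  from this(2) show ?thesis using \<open>x \<in> U\<close>
  proof (induction arbitrary: x)
    case (Int U V)
    then obtain r s where r: "r > 0" "{y. d x y < ennreal r} \<subseteq> U"
      and s: "s > 0" "{y. d x y < ennreal s} \<subseteq> V" by blast
    have "{y. d x y < ennreal (min r s)} \<subseteq> U \<inter> V"
    proof
      fix y assume "y \<in> {y. d x y < ennreal (min r s)}"
      then have "d x y < ennreal r" "d x y < ennreal s"
        using ennreal_leI[of "min r s" r] ennreal_leI[of "min r s" s] by (simp_all add: less_le_trans)
      then show "y \<in> U \<inter> V" using r s by blast
    qed
    then show ?case using r s by (intro exI[of _ "min r s"]) simp
  next
    case (UN K)
    then show ?case by (meson Sup_upper UnionE order_trans)
  next
    case (Basis U)
    then obtain a s where s: "s > 0" "U = {y. d a y < ennreal s}" by blast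
    with Basis obtain q where q: "q \<ge> 0" "d a x = ennreal q" "q < s"
      by (cases "d a x") (auto simp: ennreal_less_iff)
    have "d a y < ennreal s" if y: "d x y < ennreal (s - q)" for y
    proof -
      have "d a y \<le> ennreal q + d x y" using ext q unfolding extended_metric_def by metis
      also have "\<dots> < ennreal q + ennreal (s - q)"
        using y by (simp add: ennreal_add_left_cancel_less)
      also have "\<dots> = ennreal s" using q by (simp flip: ennreal_plus)
      finally show ?thesis .
    qed
    then show ?case using q s by (intro exI[of _ "s - q"]) auto
  qed (use zero_less_one in blast)
qed

lemma compatible_metric_dist: "compatible_metric (\<lambda>x y :: 'a::metric_space. ennreal (dist x y))"
proof -
  have ball: "{y. ennreal (dist x y) < ennreal r} = ball x r" for x :: 'a and r
    by (auto simp: ennreal_less_iff)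
  have "extended_metric (\<lambda>x y :: 'a. ennreal (dist x y))"
    unfolding extended_metric_def
    by (auto simp: dist_commute dist_triangle simp flip: ennreal_plus intro!: ennreal_leI)
  moreover have "open U \<longleftrightarrow> generate_topology {ball x r | x r. r > 0} U" for U :: "'a set"
  proof
    assume "open U"
    then obtain r where r: "\<And>x. x \<in> U \<Longrightarrow> r x > 0 \<and> ball x (r x) \<subseteq> U"
      unfolding open_contains_ball by metis
    then have "U = (\<Union>x\<in>U. ball x (r x))" by fastforce
    moreover have "generate_topology {ball x r | x r. r > 0} (\<Union>x\<in>U. ball x (r x))"
      using r by (intro generate_topology_Union generate_topology.Basis) blast
    ultimately show "generate_topology {ball x r | x r. r > 0} U" by simp
  next
    assume "generate_topology {ball x r | x r. r > 0} U"
    then show "open U" by induction auto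
  qed
  ultimately show ?thesis
    unfolding compatible_metric_def ball by (simp add: fun_eq_iff)
qed

lemma compatible_metric_small_nbhd:
  assumes d: "compatible_metric d" and "\<epsilon> > 0"
  shows "\<exists>U. open U \<and> x \<in> U \<and> (\<forall>y\<in>U. \<forall>y'\<in>U. d y y' \<le> ennreal \<epsilon>)"
proof (intro exI conjI ballI)
  let ?U = "{y. d x y < ennreal (\<epsilon> / 2)}"
  have ext: "extended_metric d" using d by (simp add: compatible_metric_def)
  show "open ?U" using d \<open>\<epsilon> > 0\<close> by (intro compatible_metric_open_ball) auto
  have "d x x = 0" using ext unfolding extended_metric_def by blast
  then show "x \<in> ?U" using \<open>\<epsilon> > 0\<close> by simp
  fix y y' assume "y \<in> ?U" "y' \<in> ?U"
  then have "d x y \<le> ennreal (\<epsilon> / 2)" "d x y' \<le> ennreal (\<epsilon> / 2)" by auto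
  moreover have "d y y' \<le> d x y + d x y'" using ext unfolding extended_metric_def by metis
  ultimately have "d y y' \<le> ennreal (\<epsilon> / 2) + ennreal (\<epsilon> / 2)"
    by (meson add_mono order_trans)
  then show "d y y' \<le> ennreal \<epsilon>" using \<open>\<epsilon> > 0\<close> by (simp flip: ennreal_plus)
qed

section \<open>A criterion for non-sensitivity\<close>

text \<open>The following predicates describe the maps in the small generating pseudo*group, one
  invariant set \<open>A\<close> at a time. Both the domain and the image are required to be small because this
  keeps the condition symmetric under inversion and stable under composition.\<close>

definition identity_on :: "'a set \<Rightarrow> ('a \<rightharpoonup> 'a) \<Rightarrow> bool"
  where "identity_on A s \<longleftrightarrow> (\<forall>x y. x \<in> A \<longrightarrow> s x = Some y \<longrightarrow> y = x)"

definition small_on :: "('a \<Rightarrow> 'a \<Rightarrow> ennreal) \<Rightarrow> real \<Rightarrow> 'a set \<Rightarrow> ('a \<rightharpoonup> 'a) \<Rightarrow> bool"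
  where "small_on d \<epsilon> A s \<longleftrightarrow>
    (\<forall>x x' y y'. x \<in> A \<longrightarrow> x' \<in> A \<longrightarrow> s x = Some y \<longrightarrow> s x' = Some y' \<longrightarrow>
      d x x' \<le> ennreal \<epsilon> \<and> d y y' \<le> ennreal \<epsilon>)"

definition tame_on :: "('a \<Rightarrow> 'a \<Rightarrow> ennreal) \<Rightarrow> real \<Rightarrow> 'a set \<Rightarrow> ('a \<rightharpoonup> 'a) \<Rightarrow> bool"
  where "tame_on d \<epsilon> A s \<longleftrightarrow>
    (\<forall>x y. s x = Some y \<longrightarrow> (x \<in> A \<longleftrightarrow> y \<in> A)) \<and> (identity_on A s \<or> small_on d \<epsilon> A s)"

lemma small_onI:
  assumes "\<And>x x' y y'. x \<in> A \<Longrightarrow> x' \<in> A \<Longrightarrow> s x = Some y \<Longrightarrow> s x' = Some y' \<Longrightarrow>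
    d x x' \<le> ennreal \<epsilon> \<and> d y y' \<le> ennreal \<epsilon>"
  shows "small_on d \<epsilon> A s"
  unfolding small_on_def by (intro allI impI) (rule assms)

lemma small_onD:
  assumes "small_on d \<epsilon> A s" "x \<in> A" "x' \<in> A" "s x = Some y" "s x' = Some y'"
  shows "d x x' \<le> ennreal \<epsilon>" "d y y' \<le> ennreal \<epsilon>"
  using assms unfolding small_on_def by blast+

lemma tame_on_Some: "tame_on d \<epsilon> A Some"
  by (simp add: tame_on_def identity_on_def)

lemma tame_on_inverse:
  assumes s: "tame_on d \<epsilon> A s" and inv: "\<And>x y. t y = Some x \<longleftrightarrow> s x = Some y"
  shows "tame_on d \<epsilon> A t"
proof -
  have A: "x \<in> A \<longleftrightarrow> y \<in> A" if "s x = Some y" for x y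
    using s that unfolding tame_on_def by blast
  have "identity_on A t" if "identity_on A s"
    using that A unfolding identity_on_def inv by blast
  moreover have "small_on d \<epsilon> A t" if "small_on d \<epsilon> A s"
    unfolding small_on_def inv using small_onD[OF that] A by blast
  ultimately show ?thesis
    using s A unfolding tame_on_def inv by blast
qed

text \<open>If one factor is the identity on \<open>A\<close>, the composition is a restriction of the other factor
  there. If both are small, the domain of the composition lies in that of \<open>f\<close> and its image in that
  of \<open>g\<close>.\<close>

lemma tame_on_map_comp:
  assumes f: "tame_on d \<epsilon> A f" and g: "tame_on d \<epsilon> A g"
  shows "tame_on d \<epsilon> A (g \<circ>\<^sub>m f)"
proof -
  have fA: "x \<in> A \<longleftrightarrow> y \<in> A" if "f x = Some y" for x y
    using f that unfolding tame_on_def by blast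
  have gA: "y \<in> A \<longleftrightarrow> z \<in> A" if "g y = Some z" for y z
    using g that unfolding tame_on_def by blast
  consider "identity_on A f" "identity_on A g" | "small_on d \<epsilon> A f" "identity_on A g"
    | "identity_on A f" "small_on d \<epsilon> A g" | "small_on d \<epsilon> A f" "small_on d \<epsilon> A g"
    using f g unfolding tame_on_def by blast
  then have "identity_on A (g \<circ>\<^sub>m f) \<or> small_on d \<epsilon> A (g \<circ>\<^sub>m f)"
  proof cases
    case 1
    then show ?thesis unfolding identity_on_def map_comp_eq_Some_iff by blast
  next
    case 2
    have "small_on d \<epsilon> A (g \<circ>\<^sub>m f)"
    proof (rule small_onI)
      fix x x' z z' assume x: "x \<in> A" "x' \<in> A" and "(g \<circ>\<^sub>m f) x = Some z" "(g \<circ>\<^sub>m f) x' = Some z'"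
      then obtain y y' where y: "f x = Some y" "g y = Some z" "f x' = Some y'" "g y' = Some z'"
        unfolding map_comp_eq_Some_iff by blast
      then have "z = y" "z' = y'" using 2(2) fA x unfolding identity_on_def by blast+
      then show "d x x' \<le> ennreal \<epsilon> \<and> d z z' \<le> ennreal \<epsilon>"
        using small_onD[OF 2(1) x y(1,3)] by simp
    qed
    then show ?thesis ..
  next
    case 3
    have "small_on d \<epsilon> A (g \<circ>\<^sub>m f)"
    proof (rule small_onI)
      fix x x' z z' assume x: "x \<in> A" "x' \<in> A" and "(g \<circ>\<^sub>m f) x = Some z" "(g \<circ>\<^sub>m f) x' = Some z'"
      then obtain y y' where y: "f x = Some y" "g y = Some z" "f x' = Some y'" "g y' = Some z'"
        unfolding map_comp_eq_Some_iff by blast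
      then have "y = x" "y' = x'" using 3(1) x unfolding identity_on_def by blast+
      then show "d x x' \<le> ennreal \<epsilon> \<and> d z z' \<le> ennreal \<epsilon>"
        using small_onD[OF 3(2) x, of z z'] y by simp
    qed
    then show ?thesis ..
  next
    case 4
    have "small_on d \<epsilon> A (g \<circ>\<^sub>m f)"
    proof (rule small_onI)
      fix x x' z z' assume x: "x \<in> A" "x' \<in> A" and "(g \<circ>\<^sub>m f) x = Some z" "(g \<circ>\<^sub>m f) x' = Some z'"
      then obtain y y' where y: "f x = Some y" "g y = Some z" "f x' = Some y'" "g y' = Some z'"
        unfolding map_comp_eq_Some_iff by blast
      then have "y \<in> A" "y' \<in> A" using fA x by blast+
      then show "d x x' \<le> ennreal \<epsilon> \<and> d z z' \<le> ennreal \<epsilon>"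
        using small_onD(1)[OF 4(1) x y(1,3)] small_onD(2)[OF 4(2) _ _ y(2,4)] by blast
    qed
    then show ?thesis ..
  qed
  moreover have "x \<in> A \<longleftrightarrow> z \<in> A" if "(g \<circ>\<^sub>m f) x = Some z" for x z
    using that fA gA unfolding map_comp_eq_Some_iff by blast
  ultimately show ?thesis unfolding tame_on_def by blast
qed

lemma tame_on_restrict_map:
  assumes "tame_on d \<epsilon> A s"
  shows "tame_on d \<epsilon> A (s |` U)"
proof -
  have "identity_on A s \<Longrightarrow> identity_on A (s |` U)" "small_on d \<epsilon> A s \<Longrightarrow> small_on d \<epsilon> A (s |` U)"
    unfolding identity_on_def small_on_def restrict_map_eq_Some_iff by blast+
  then show ?thesis
    using assms unfolding tame_on_def restrict_map_eq_Some_iff by blast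
qed

definition tame_on_blocks ::
    "(nat \<Rightarrow> 'a set) \<Rightarrow> ('a \<Rightarrow> 'a \<Rightarrow> ennreal) \<Rightarrow> ('a \<rightharpoonup> 'a) set"
  where "tame_on_blocks B d = {s. \<forall>n. tame_on d (1 / Suc n) (B n) s}"

lemma pseudo_star_group_tame:
  assumes \<G>: "pseudo_star_group \<G>"
  shows "pseudo_star_group (\<G> \<inter> tame_on_blocks B d)"
proof -
  have "map_inv f \<in> tame_on_blocks B d" if "f \<in> \<G>" "f \<in> tame_on_blocks B d" for f
  proof -
    have "f \<in> partial_homeos" using \<G> that(1) by (auto simp: pseudo_star_group_def)
    from map_inv_eq_Some_iff[OF this] show ?thesis
      using that(2) unfolding tame_on_blocks_def by (blast intro: tame_on_inverse)
  qed
  moreover have "Some \<in> tame_on_blocks B d"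
    by (simp add: tame_on_blocks_def tame_on_Some)
  moreover have "g \<circ>\<^sub>m f \<in> tame_on_blocks B d"
    if "g \<in> tame_on_blocks B d" "f \<in> tame_on_blocks B d" for f g
    using that by (simp add: tame_on_blocks_def tame_on_map_comp)
  moreover have "f |` U \<in> tame_on_blocks B d" if "f \<in> tame_on_blocks B d" for f U
    using that by (simp add: tame_on_blocks_def tame_on_restrict_map)
  ultimately show ?thesis
    using \<G> by (simp add: pseudo_star_group_def le_infI1)
qed

text \<open>To refute a constant \<open>c\<close>, take a point of a \<open>B n\<close> with \<open>1/(n + 1) < c\<close> and a ball around it
  inside \<open>B n\<close> of radius at most \<open>c\<close>. A tame map either fixes the points of the ball in its domain, so that
  they stay closer than \<open>c\<close>, or has small image on \<open>B n\<close>.\<close>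

lemma tame_not_sensitive:
  assumes d: "compatible_metric d" and B: "\<And>n. open (B n)" "\<And>n. B n \<noteq> {}"
  shows "\<not> sensitive_wrt (\<G> \<inter> tame_on_blocks B d) d"
proof
  assume "sensitive_wrt (\<G> \<inter> tame_on_blocks B d) d"
  then obtain c :: real where "c > 0"
    and c: "\<And>x (r::real). r > 0 \<Longrightarrow> \<exists>s\<in>\<G> \<inter> tame_on_blocks B d. \<exists>y. x \<in> dom s \<and> y \<in> dom s \<and>
        d x y < ennreal r \<and> d (the (s x)) (the (s y)) \<ge> ennreal c"
    unfolding sensitive_wrt_def by blast
  obtain n where n: "1 / Suc n < c"
    using reals_Archimedean[OF \<open>c > 0\<close>] by (auto simp: inverse_eq_divide)
  obtain x where x: "x \<in> B n" using B by blast
  obtain r where r: "r > 0" "{y. d x y < ennreal r} \<subseteq> B n"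
    using compatible_metric_ball_subset[OF d B(1) x] by blast
  obtain s y where s: "s \<in> tame_on_blocks B d" "x \<in> dom s" "y \<in> dom s"
      "d x y < ennreal (min r c)" "d (the (s x)) (the (s y)) \<ge> ennreal c"
    using c[of "min r c" x] r \<open>c > 0\<close> by auto
  have xy: "d x y < ennreal r" "d x y < ennreal c"
    using s(4) ennreal_leI[of "min r c" r] ennreal_leI[of "min r c" c]
    by (simp_all add: less_le_trans)
  then have y: "y \<in> B n" using r by blast
  obtain x' y' where x': "s x = Some x'" and y': "s y = Some y'" using s by blast
  have "identity_on (B n) s \<or> small_on d (1 / Suc n) (B n) s"
    using s(1) by (simp add: tame_on_blocks_def tame_on_def)
  then have "(x' = x \<and> y' = y) \<or> d x' y' \<le> ennreal (1 / Suc n)"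
    using x y x' y' small_onD(2)[of d "1 / Suc n" "B n" s x y x' y'] unfolding identity_on_def by blast
  moreover have "ennreal (1 / Suc n) < ennreal c"
    using n \<open>c > 0\<close> by (intro ennreal_lessI) auto
  ultimately have "d x' y' < ennreal c" using xy by auto
  then show False using s(5) x' y' by simp
qed

lemma action_homeos_partial_homeos:
  assumes "action_by_homeos G \<phi>"
  shows "action_homeos G \<phi> \<subseteq> partial_homeos"
proof
  fix f assume "f \<in> action_homeos G \<phi>"
  then obtain g where g: "g \<in> carrier G" "f = (\<lambda>x. Some (\<phi> g x))"
    by (auto simp: action_homeos_def)
  with assms obtain h where h: "homeomorphism UNIV UNIV (\<phi> g) h"
    by (auto simp: action_by_homeos_def)
  then have "range (\<phi> g) = UNIV" by (simp add: homeomorphism_def)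
  then have "dom f = UNIV" "ran f = UNIV" using g by (auto simp: ran_def image_def set_eq_iff) metis
  then show "f \<in> partial_homeos" using g h by (auto simp: partial_homeos_def)
qed

text \<open>The non-sensitivity criterion. Near \<open>x\<close> only finitely many \<open>B n\<close> meet the points moved by \<open>g\<close>; if
  these all have \<open>n \<le> N\<close>, then restricting \<open>g\<close> to a neighbourhood that has, like its image, diameter
  at most \<open>1/(N + 1)\<close> gives a tame map. So the tame elements of the pseudogroup contain all germs of
  the action, and closure under combinations recovers the action from them.\<close>

lemma action_pseudogroup_not_sensitive:
  fixes \<phi> :: "'g \<Rightarrow> 'a \<Rightarrow> 'a::topological_space" and d :: "'a \<Rightarrow> 'a \<Rightarrow> ennreal"
  assumes act: "action_by_homeos G \<phi>" and d: "compatible_metric d"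
    and B: "\<And>n :: nat. open (B n)" "\<And>n. B n \<noteq> {}"
    and inv: "\<And>g n x. g \<in> carrier G \<Longrightarrow> \<phi> g x \<in> B n \<longleftrightarrow> x \<in> B n"
    and fin: "\<And>g x. g \<in> carrier G \<Longrightarrow>
      \<exists>U. open U \<and> x \<in> U \<and> finite {n. \<exists>y\<in>U \<inter> B n. \<phi> g y \<noteq> y}"
  shows "\<exists>\<G>. generates_pseudogroup (action_homeos G \<phi>) \<G> \<and> \<not> pseudogroup_sensitive \<G>"
proof -
  note ph = action_homeos_partial_homeos[OF act]
  obtain \<G> where gen: "generates_pseudogroup (action_homeos G \<phi>) \<G>"
    using generated_pseudogroup_exists[OF ph] by blast
  then have \<G>: "pseudogroup \<G>" "pseudo_star_group \<G>" "action_homeos G \<phi> \<subseteq> \<G>"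
    by (auto simp: generates_pseudogroup_def pseudogroup_def)
  define \<S> where "\<S> = \<G> \<inter> tame_on_blocks B d"
  have local: "\<exists>U. open U \<and> x \<in> U \<and> f |` U \<in> \<S>" if f: "f \<in> action_homeos G \<phi>" for f x
  proof -
    obtain g where g: "g \<in> carrier G" "f = (\<lambda>x. Some (\<phi> g x))"
      using f by (auto simp: action_homeos_def)
    obtain U where U: "open U" "x \<in> U" and finU: "finite {n. \<exists>y\<in>U \<inter> B n. \<phi> g y \<noteq> y}"
      using fin[OF g(1)] by blast
    obtain N where N: "\<And>n. n \<in> {n. \<exists>y\<in>U \<inter> B n. \<phi> g y \<noteq> y} \<Longrightarrow> n \<le> N"
      using finU finite_nat_set_iff_bounded_le by auto
    have pos: "0 < 1 / real (Suc N)" by simp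
    obtain V where V: "open V" "x \<in> V" "\<And>y y'. y \<in> V \<Longrightarrow> y' \<in> V \<Longrightarrow> d y y' \<le> ennreal (1 / Suc N)"
      using compatible_metric_small_nbhd[OF d pos] by metis
    obtain W where W: "open W" "\<phi> g x \<in> W"
      "\<And>y y'. y \<in> W \<Longrightarrow> y' \<in> W \<Longrightarrow> d y y' \<le> ennreal (1 / Suc N)"
      using compatible_metric_small_nbhd[OF d pos] by metis
    have "continuous_on UNIV (\<phi> g)"
      using act g(1) by (auto simp: action_by_homeos_def homeomorphism_def)
    then have opn: "open (U \<inter> V \<inter> \<phi> g -` W)"
      using U V W by (auto intro!: open_Int open_vimage)
    let ?U = "U \<inter> V \<inter> \<phi> g -` W"
    have "f |` ?U \<in> \<G>"
      using \<G>(2,3) f opn g(2) unfolding pseudo_star_group_def by auto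
    moreover have "f |` ?U \<in> tame_on_blocks B d"
      unfolding tame_on_blocks_def mem_Collect_eq
    proof
      fix n
      have "identity_on (B n) (f |` ?U) \<or> small_on d (1 / Suc n) (B n) (f |` ?U)"
      proof (cases "n \<le> N")
        case True
        then have le: "ennreal (1 / Suc N) \<le> ennreal (1 / Suc n)"
          by (intro ennreal_leI) (simp add: field_simps)
        have "small_on d (1 / Suc n) (B n) (f |` ?U)"
          using order_trans[OF V(3) le] order_trans[OF W(3) le] g(2)
          by (intro small_onI) (auto simp: restrict_map_eq_Some_iff)
        then show ?thesis ..
      next
        case False
        then have "identity_on (B n) (f |` ?U)"
          using N[of n] g(2) by (auto simp: identity_on_def restrict_map_eq_Some_iff)
        then show ?thesis ..
      qed
      then show "tame_on d (1 / Suc n) (B n) (f |` ?U)"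
        using inv[OF g(1)] g(2) by (auto simp: tame_on_def restrict_map_eq_Some_iff)
    qed
    ultimately show ?thesis using opn U V W unfolding \<S>_def by blast
  qed
  have "\<G> \<subseteq> \<H>" if \<H>: "pseudogroup \<H>" "\<S> \<subseteq> \<H>" for \<H>
  proof -
    have "f \<in> \<H>" if f: "f \<in> action_homeos G \<phi>" for f
    proof -
      have "dom f = UNIV" using f by (auto simp: action_homeos_def)
      moreover have "f \<in> partial_homeos" using ph f by blast
      moreover have "\<forall>x\<in>dom f. \<exists>U. open U \<and> x \<in> U \<and> U \<subseteq> dom f \<and> f |` U \<in> \<H>"
      proof
        fix x
        obtain U where "open U" "x \<in> U" "f |` U \<in> \<S>" using local[OF f, of x] by blast
        then show "\<exists>U. open U \<and> x \<in> U \<and> U \<subseteq> dom f \<and> f |` U \<in> \<H>"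
          using \<H>(2) \<open>dom f = UNIV\<close> by (intro exI[of _ U]) (simp add: subsetD)
      qed
      ultimately show ?thesis using \<H>(1) by (simp add: pseudogroup_def)
    qed
    then show ?thesis using gen \<H>(1) by (auto simp: generates_pseudogroup_def)
  qed
  then have "generates_pseudogroup \<S> \<G>"
    using \<G>(1) by (auto simp: generates_pseudogroup_def \<S>_def)
  moreover have "pseudo_star_group \<S>" "\<not> sensitive_wrt \<S> d"
    using pseudo_star_group_tame[OF \<G>(2)] tame_not_sensitive[where B = B, OF d B]
    by (simp_all add: \<S>_def)
  ultimately have "\<not> pseudogroup_sensitive \<G>"
    using d unfolding pseudogroup_sensitive_def \<S>_def by blast
  then show ?thesis using gen by blast
qed

section \<open>Shears of the torus\<close>

lemma continuous_on_abs_torus: "continuous_on S abs_torus"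
proof (rule continuous_on_subset)
  show "continuous_on UNIV abs_torus"
    by (simp add: continuous_on_open_vimage open_torus_def)
qed simp

lemma continuous_on_torus_lift:
  fixes f :: "torus \<Rightarrow> 'a::topological_space"
  assumes "continuous_on UNIV (\<lambda>p. f (abs_torus p))"
  shows "continuous_on UNIV f"
  using assms by (simp add: continuous_on_open_vimage open_torus_def vimage_def)

lemma infdist_Ints_le: "k \<in> \<int> \<Longrightarrow> infdist t \<int> \<le> \<bar>t - k\<bar>" for t :: real
  using infdist_le[of k \<int> t] by (simp add: dist_real_def)

lemma infdist_Ints_cong:
  fixes s t :: real
  assumes "s - t \<in> \<int>"
  shows "infdist s \<int> = infdist t \<int>"
proof -
  have le: "infdist s \<int> \<le> infdist t \<int>" if "s - t \<in> \<int>" for s t :: real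
  proof -
    have "infdist s \<int> \<le> dist t k" if "k \<in> \<int>" for k
      using infdist_Ints_le[OF Ints_add[OF that \<open>s - t \<in> \<int>\<close>], of s]
      by (simp add: dist_real_def algebra_simps)
    then show ?thesis
      unfolding infdist_def[of t] by (auto intro!: cINF_greatest)
  qed
  have "t - s \<in> \<int>" using assms by (metis Ints_minus minus_diff_eq)
  then show ?thesis using le[of s t] le[of t s] assms by simp
qed

lemma infdist_Ints_le_half: "infdist t \<int> \<le> 1 / 2" for t :: real
  using infdist_Ints_le[of "of_int (round t)" t] of_int_round_abs_le[of t] by (simp add: abs_minus_commute)

text \<open>From a non-integer, moving towards a nearest integer decreases the distance; at an
  integer, any small move makes it positive.\<close>

lemma infdist_Ints_not_locally_constant:
  fixes y :: real
  assumes "r > 0"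
  shows "\<exists>y'. \<bar>y - y'\<bar> < r \<and> infdist y \<int> \<noteq> infdist y' \<int>"
proof (cases "y \<in> \<int>")
  case True
  define e where "e = min (r / 2) (1 / 2)"
  have e: "0 < e" "e < 1" "e < r" using assms by (auto simp: e_def)
  have "y + e \<notin> \<int>"
  proof
    assume "y + e \<in> \<int>"
    then have "e \<in> \<int>" using True Ints_diff by fastforce
    then show False using e Ints_nonzero_abs_less1[of e] by simp
  qed
  then have "infdist (y + e) \<int> \<noteq> 0"
    using in_closed_iff_infdist_zero[of \<int> "y + e"] closed_Ints by auto
  moreover have "infdist y \<int> = 0" using True by simp
  ultimately show ?thesis using e by (intro exI[of _ "y + e"]) auto
next
  case False
  obtain k where k: "k \<in> \<int>" "infdist y \<int> = dist y k"
    using infdist_attains_inf[OF closed_Ints] Ints_0 by (metis empty_iff)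
  define e where "e = min (1 / 2) (r / (2 * \<bar>y - k\<bar>))"
  have yk: "\<bar>y - k\<bar> > 0" using False k by auto
  then have e: "0 < e" "e < 1" using assms by (auto simp: e_def)
  have "e * \<bar>y - k\<bar> \<le> r / (2 * \<bar>y - k\<bar>) * \<bar>y - k\<bar>"
    by (intro mult_right_mono) (auto simp: e_def)
  also have "\<dots> < r" using yk assms by simp
  finally have "\<bar>y - (y - e * (y - k))\<bar> < r" using e by (simp add: abs_mult)
  moreover have "infdist (y - e * (y - k)) \<int> < infdist y \<int>"
  proof -
    have "infdist (y - e * (y - k)) \<int> \<le> \<bar>y - e * (y - k) - k\<bar>"
      using k by (intro infdist_Ints_le)
    also have "y - e * (y - k) - k = (1 - e) * (y - k)" by (simp add: algebra_simps)
    also have "\<bar>(1 - e) * (y - k)\<bar> = (1 - e) * \<bar>y - k\<bar>" using e by (simp add: abs_mult)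
    also have "\<dots> < \<bar>y - k\<bar>" using e yk by simp
    finally show ?thesis using k by (simp add: dist_real_def)
  qed
  ultimately show ?thesis by (intro exI[of _ "y - e * (y - k)"]) simp
qed

lift_definition height :: "torus \<Rightarrow> real" is "\<lambda>p. infdist (snd p) \<int>"
  by (auto simp: mem_Times_iff intro: infdist_Ints_cong)

lift_definition shear :: "(real \<Rightarrow> real) \<Rightarrow> torus \<Rightarrow> torus"
  is "\<lambda>H p. (fst p + H (infdist (snd p) \<int>), snd p)"
proof -
  fix H :: "real \<Rightarrow> real" and p q :: "real \<times> real"
  assume "p - q \<in> \<int> \<times> \<int>"
  then show "(fst p + H (infdist (snd p) \<int>), snd p) - (fst q + H (infdist (snd q) \<int>), snd q) \<in> \<int> \<times> \<int>"
    using infdist_Ints_cong[of "snd p" "snd q"] by (simp add: mem_Times_iff)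
qed

lemma continuous_on_height: "continuous_on UNIV height"
  by (rule continuous_on_torus_lift) (simp add: height.abs_eq continuous_intros)

lemma continuous_on_shear:
  assumes "continuous_on UNIV H"
  shows "continuous_on UNIV (shear H)"
proof (rule continuous_on_torus_lift)
  have "continuous_on UNIV (\<lambda>p :: real \<times> real. (fst p + H (infdist (snd p) \<int>), snd p))"
    by (intro continuous_intros continuous_on_compose2[OF assms]) auto
  then show "continuous_on UNIV (\<lambda>p. shear H (abs_torus p))"
    unfolding shear.abs_eq by (rule continuous_on_compose2[OF continuous_on_abs_torus]) auto
qed

lemma height_shear [simp]: "height (shear H P) = height P"
  by transfer simp

lemma shear_shear: "shear H (shear K P) = shear (\<lambda>t. H t + K t) P"
  by transfer (simp add: algebra_simps zero_prod_def)

lemma shear_eq_self: "H (height P) = 0 \<Longrightarrow> shear H P = P"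
  by transfer (simp add: zero_prod_def)

text \<open>A lower bound for the flat metric: project the torus to the first circle factor.\<close>

lemma infdist_le_dist_torus: "infdist (fst p - fst q) \<int> \<le> dist (abs_torus p) (abs_torus q)"
proof (rule field_le_epsilon)
  fix e :: real assume "e > 0"
  then obtain q' where q': "abs_torus q' = abs_torus q" "dist p q' < dist (abs_torus p) (abs_torus q) + e"
    using dist_torus_lessE[of p "abs_torus q"] by (metis less_add_same_cancel1)
  then have "fst q' - fst q \<in> \<int>" by (auto simp: abs_torus_eq_iff mem_Times_iff)
  then have "infdist (fst p - fst q) \<int> \<le> \<bar>(fst p - fst q) - (fst q' - fst q)\<bar>"
    by (rule infdist_Ints_le)
  also have "\<dots> \<le> dist p q'" using dist_fst_le[of p q'] by (simp add: dist_real_def)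
  finally show "infdist (fst p - fst q) \<int> \<le> dist (abs_torus p) (abs_torus q) + e" using q' by simp
qed

section \<open>Actions of free groups by shears\<close>

text \<open>A word \<open>w\<close> shears along the function \<open>word_shift h w\<close>, the sum of the \<open>h i\<close> weighted by the
  exponent sums of \<open>w\<close>. As values add, cancelling a letter with its inverse changes nothing, and the
  sum is a homomorphism on reduced words.\<close>

definition letter_shift :: "('i \<Rightarrow> real \<Rightarrow> real) \<Rightarrow> 'i \<times> bool \<Rightarrow> real \<Rightarrow> real"
  where "letter_shift h x t = (if snd x then h (fst x) t else - h (fst x) t)"

definition word_shift :: "('i \<Rightarrow> real \<Rightarrow> real) \<Rightarrow> ('i \<times> bool) list \<Rightarrow> real \<Rightarrow> real"
  where "word_shift h w t = (\<Sum>x\<leftarrow>w. letter_shift h x t)"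

lemma word_shift_push_letter: "word_shift h (push_letter x w) t = letter_shift h x t + word_shift h w t"
  by (cases w) (auto simp: word_shift_def letter_shift_def inv_letter_def)

lemma word_shift_mult:
  "word_shift h (u \<otimes>\<^bsub>free_group I\<^esub> v) t = word_shift h u t + word_shift h v t"
proof -
  have "word_shift h (foldr push_letter u v) t = word_shift h u t + word_shift h v t"
    by (induction u) (simp_all add: word_shift_push_letter, simp_all add: word_shift_def)
  then show ?thesis by (simp add: free_group_def)
qed

lemma continuous_on_word_shift:
  assumes "\<And>i. continuous_on UNIV (h i)"
  shows "continuous_on UNIV (word_shift h w)"
proof (induction w)
  case Nil
  show ?case by (simp add: word_shift_def[abs_def])
next
  case (Cons x w)
  have "word_shift h (x # w) = (\<lambda>t. letter_shift h x t + word_shift h w t)"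
    by (simp add: word_shift_def[abs_def])
  moreover have "continuous_on UNIV (letter_shift h x)"
    using assms by (cases "snd x") (auto simp: letter_shift_def[abs_def] intro: continuous_intros)
  ultimately show ?case using Cons.IH by (auto intro: continuous_intros)
qed

lemma word_shift_eq_0:
  assumes "\<And>i. i \<in> fst ` set w \<Longrightarrow> h i t = 0"
  shows "word_shift h w t = 0"
  using assms by (induction w) (auto simp: word_shift_def letter_shift_def)

lemma action_by_homeosI:
  fixes \<phi> :: "'g \<Rightarrow> 'a \<Rightarrow> 'a::topological_space"
  assumes G: "group G"
    and one: "\<And>x. \<phi> \<one>\<^bsub>G\<^esub> x = x"
    and mult: "\<And>g h x. g \<in> carrier G \<Longrightarrow> h \<in> carrier G \<Longrightarrow> \<phi> (g \<otimes>\<^bsub>G\<^esub> h) x = \<phi> g (\<phi> h x)"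
    and cont: "\<And>g. g \<in> carrier G \<Longrightarrow> continuous_on UNIV (\<phi> g)"
  shows "action_by_homeos G \<phi>"
proof -
  interpret group G by fact
  have hom: "homeomorphism UNIV UNIV (\<phi> g) (\<phi> (inv\<^bsub>G\<^esub> g))" if g: "g \<in> carrier G" for g
  proof -
    have "\<phi> (inv\<^bsub>G\<^esub> g) (\<phi> g x) = x" "\<phi> g (\<phi> (inv\<^bsub>G\<^esub> g) x) = x" for x
      using g one by (simp_all flip: mult)
    then show ?thesis using g by (auto intro!: homeomorphismI cont)
  qed
  have "bij (\<phi> g)" if "g \<in> carrier G" for g
    by (rule bij_betw_byWitness[where f' = "\<phi> (inv\<^bsub>G\<^esub> g)"])
      (use hom[OF that] in \<open>auto simp: homeomorphism_def\<close>)
  then have "group_action G UNIV \<phi>"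
    unfolding group_action_def group_hom_def group_hom_axioms_def
    using G group_BijGroup[of "UNIV :: 'a set"]
    by (auto simp: hom_def BijGroup_def Bij_def compose_def mult)
  then show ?thesis using hom unfolding action_by_homeos_def by blast
qed

lemma shear_action:
  assumes "\<And>i. continuous_on UNIV (h i)"
  shows "action_by_homeos (free_group I) (\<lambda>w. shear (word_shift h w))"
proof (rule action_by_homeosI[OF free_group_is_group])
  show "shear (word_shift h \<one>\<^bsub>free_group I\<^esub>) P = P" for P
    by (rule shear_eq_self) (simp add: word_shift_def free_group_def)
  show "shear (word_shift h (u \<otimes>\<^bsub>free_group I\<^esub> v)) P = shear (word_shift h u) (shear (word_shift h v) P)"
    for u v P
    by (simp add: shear_shear word_shift_mult[abs_def])
qed (intro continuous_on_shear continuous_on_word_shift assms)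

lemma shear_action_fibres:
  assumes "\<And>i. continuous_on UNIV (h i)"
  shows "action_by_homeos (free_group I)
    (\<lambda>w x :: torus \<times> 'z::topological_space. (shear (word_shift h w) (fst x), snd x))"
proof (rule action_by_homeosI[OF free_group_is_group])
  show "continuous_on UNIV (\<lambda>x :: torus \<times> 'z. (shear (word_shift h w) (fst x), snd x))" for w
    by (intro continuous_intros continuous_on_compose2[OF continuous_on_shear]
        continuous_on_word_shift assms) auto
  show "(shear (word_shift h \<one>\<^bsub>free_group I\<^esub>) (fst x), snd x) = x" for x :: "torus \<times> 'z"
    by (simp add: shear_eq_self word_shift_def free_group_def)
qed (simp add: shear_shear word_shift_mult[abs_def])

text \<open>The first multiple of \<open>\<bar>\<delta>\<bar>\<close> that is at least \<open>1/4\<close> exceeds \<open>1/4\<close> by less than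
  \<open>\<bar>\<delta>\<bar> \<le> 1/2\<close>, so it has not passed \<open>3/4\<close>.\<close>

lemma multiple_far_from_Ints:
  fixes \<delta> :: real
  assumes "0 < \<bar>\<delta>\<bar>" "\<bar>\<delta>\<bar> \<le> 1 / 2"
  obtains m :: nat where "1 / 4 \<le> infdist (m * \<delta>) \<int>"
proof -
  define m where "m = nat \<lceil>1 / (4 * \<bar>\<delta>\<bar>)\<rceil>"
  have pos: "0 < 1 / (4 * \<bar>\<delta>\<bar>)" using assms by simp
  then have "1 / (4 * \<bar>\<delta>\<bar>) \<le> m" "m < 1 / (4 * \<bar>\<delta>\<bar>) + 1"
    unfolding m_def by linarith+
  then have "1 / 4 \<le> m * \<bar>\<delta>\<bar>" "m * \<bar>\<delta>\<bar> < 1 / 4 + \<bar>\<delta>\<bar>"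
    using assms by (auto simp: field_simps)
  then have m: "1 / 4 \<le> \<bar>m * \<delta>\<bar>" "\<bar>m * \<delta>\<bar> \<le> 3 / 4"
    using assms(2) by (simp_all add: abs_mult)
  obtain k where k: "k \<in> \<int>" "infdist (m * \<delta>) \<int> = dist (m * \<delta>) k"
    using infdist_attains_inf[OF closed_Ints] Ints_0 by (metis empty_iff)
  have "k = 0 \<or> 1 \<le> \<bar>k\<bar>"
    using k(1) Ints_nonzero_abs_ge1 by blast
  then have "1 / 4 \<le> infdist (m * \<delta>) \<int>"
    using m unfolding k(2) dist_real_def by linarith
  then show ?thesis by (rule that)
qed

text \<open>Expansion near an arbitrary point of the torus: move \<open>P\<close> vertically by less than \<open>r\<close> to change
  its height, choose a generator \<open>i\<close> whose shift differs at the two heights, and apply the power of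
  \<open>i\<close> that amplifies this difference. Only heights in \<open>[0, 1/2]\<close> occur.\<close>

lemma shear_action_expands:
  assumes sep: "\<And>s t. 0 \<le> s \<Longrightarrow> s < t \<Longrightarrow> t \<le> 1 / 2 \<Longrightarrow> \<exists>i\<in>I. 0 < h i t - h i s \<and> h i t - h i s \<le> 1 / 2"
    and "r > 0"
  obtains Q w where "dist P Q < r" "w \<in> carrier (free_group I)"
    "1 / 4 \<le> dist (shear (word_shift h w) P) (shear (word_shift h w) Q)"
proof -
  obtain p where p: "abs_torus p = P" using abs_torus_surj by blast
  obtain y where y: "\<bar>snd p - y\<bar> < r" "infdist (snd p) \<int> \<noteq> infdist y \<int>"
    using infdist_Ints_not_locally_constant[OF \<open>r > 0\<close>] by blast
  let ?s = "infdist (snd p) \<int>" and ?t = "infdist y \<int>"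
  obtain i where i: "i \<in> I" "0 < \<bar>h i ?s - h i ?t\<bar>" "\<bar>h i ?s - h i ?t\<bar> \<le> 1 / 2"
  proof (cases "?s < ?t")
    case True
    then show ?thesis
      using sep[of ?s ?t] infdist_nonneg[of "snd p" \<int>] infdist_Ints_le_half[of y] that by fastforce
  next
    case False
    then have "?t < ?s" using y by simp
    then show ?thesis
      using sep[of ?t ?s] infdist_nonneg[of y \<int>] infdist_Ints_le_half[of "snd p"] that by fastforce
  qed
  obtain m :: nat where m: "1 / 4 \<le> infdist (m * (h i ?s - h i ?t)) \<int>"
    using multiple_far_from_Ints i by blast
  define w where "w = replicate m (i, True)"
  have w: "word_shift h w t = m * h i t" for t
    by (simp add: w_def word_shift_def letter_shift_def map_replicate_const sum_list_replicate)
  define q where "q = (fst p, y)"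
  have "dist p q < r" using y by (simp add: q_def dist_prod_def dist_real_def)
  then have "dist P (abs_torus q) < r" using dist_torus_le[of p q] p by simp
  moreover have "w \<in> carrier (free_group I)"
  proof -
    have "reduced_word w"
      unfolding w_def by (induction m rule: induct_nat_012) (auto simp: inv_letter_def)
    then show ?thesis using i by (auto simp: free_group_def w_def)
  qed
  moreover have "1 / 4 \<le> dist (shear (word_shift h w) P) (shear (word_shift h w) (abs_torus q))"
  proof -
    have "1 / 4 \<le> infdist (m * (h i ?s - h i ?t)) \<int>" by (rule m)
    also have "\<dots> \<le> dist (shear (word_shift h w) (abs_torus p)) (shear (word_shift h w) (abs_torus q))"
      unfolding shear.abs_eq
      by (rule order_trans[OF _ infdist_le_dist_torus]) (simp add: q_def w algebra_simps)
    finally show ?thesis using p by simp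
  qed
  ultimately show ?thesis by (rule that)
qed

section \<open>The two actions\<close>

theorem theorem1p8:
  shows "(\<forall>d. compatible_metric d \<and> flat_on_fibres d \<longrightarrow>
      (\<exists>\<phi> :: (nat \<times> bool) list \<Rightarrow> torus \<times> int \<Rightarrow> torus \<times> int.
        action_by_homeos (free_group {0, 1}) \<phi> \<and>
        action_sensitive (free_group {0, 1}) \<phi> d \<and>
        (\<exists>\<G>. generates_pseudogroup (action_homeos (free_group {0, 1}) \<phi>) \<G> \<and>
          \<not> pseudogroup_sensitive \<G>)))
    \<and> (\<exists>\<phi> :: (nat \<times> bool) list \<Rightarrow> torus \<Rightarrow> torus.
        action_by_homeos (free_group UNIV) \<phi> \<and>
        action_sensitive (free_group UNIV) \<phi> (\<lambda>P Q. ennreal (dist P Q)) \<and>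
        (\<exists>\<G>. generates_pseudogroup (action_homeos (free_group UNIV) \<phi>) \<G> \<and>
          \<not> pseudogroup_sensitive \<G>))"
proof (intro conjI allI impI)
  fix d :: "torus \<times> int \<Rightarrow> torus \<times> int \<Rightarrow> ennreal"
  assume "compatible_metric d \<and> flat_on_fibres d"
  then have d: "compatible_metric d" and flat: "\<And>z P Q. d (P, z) (Q, z) = ennreal (dist P Q)"
    by (auto simp: flat_on_fibres_def)
  let ?G = "free_group {0, 1 :: nat}"
  \<comment> \<open>both generators act alike: a single shear is already sensitive\<close>
  define h :: "nat \<Rightarrow> real \<Rightarrow> real" where "h i t = t" for i t
  define \<phi> where "\<phi> w x = (shear (word_shift h w) (fst x), snd x)" for w and x :: "torus \<times> int"
  have act: "action_by_homeos ?G \<phi>"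
    unfolding \<phi>_def[abs_def] by (rule shear_action_fibres) (simp add: h_def[abs_def])
  moreover have "action_sensitive ?G \<phi> d"
    unfolding action_sensitive_def
  proof (intro exI[of _ "1/4 :: real"] conjI allI impI)
    fix x :: "torus \<times> int" and r :: real assume "r > 0"
    obtain Q w where "dist (fst x) Q < r" "w \<in> carrier ?G"
      "1 / 4 \<le> dist (shear (word_shift h w) (fst x)) (shear (word_shift h w) Q)"
      by (rule shear_action_expands[of "{0, 1}" h r "fst x"]) (use \<open>r > 0\<close> in \<open>auto simp: h_def\<close>)
    then show "\<exists>y. d x y < ennreal r \<and> (\<exists>g\<in>carrier ?G. ennreal (1 / 4) \<le> d (\<phi> g x) (\<phi> g y))"
      by (intro exI[of _ "(Q, snd x)"] conjI bexI[of _ w])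
        (cases x, auto simp: \<phi>_def flat ennreal_less_iff intro!: ennreal_leI)+
  qed simp
  moreover have "\<exists>\<G>. generates_pseudogroup (action_homeos ?G \<phi>) \<G> \<and> \<not> pseudogroup_sensitive \<G>"
  proof (rule action_pseudogroup_not_sensitive[OF act d, where B = "\<lambda>n. UNIV \<times> {int n}"])
    fix w and x :: "torus \<times> int"
    have "{n. \<exists>y\<in>(UNIV \<times> {snd x}) \<inter> (UNIV \<times> {int n}). \<phi> w y \<noteq> y} \<subseteq> {nat (snd x)}" by auto
    then have "finite {n. \<exists>y\<in>(UNIV \<times> {snd x}) \<inter> (UNIV \<times> {int n}). \<phi> w y \<noteq> y}"
      by (rule finite_subset) simp
    then show "\<exists>U. open U \<and> x \<in> U \<and> finite {n. \<exists>y\<in>U \<inter> (UNIV \<times> {int n}). \<phi> w y \<noteq> y}"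
      by (intro exI[of _ "UNIV \<times> {snd x}"]) (auto simp: open_Times open_discrete mem_Times_iff)
  qed (auto simp: \<phi>_def open_Times open_discrete mem_Times_iff)
  ultimately show "\<exists>\<phi>. action_by_homeos ?G \<phi> \<and> action_sensitive ?G \<phi> d \<and>
      (\<exists>\<G>. generates_pseudogroup (action_homeos ?G \<phi>) \<G> \<and> \<not> pseudogroup_sensitive \<G>)"
    by blast
next
  let ?G = "free_group (UNIV :: nat set)" and ?d = "\<lambda>P Q :: torus. ennreal (dist P Q)"
  \<comment> \<open>\<open>h i\<close> vanishes up to \<open>1/(i + 1)\<close>, so it acts trivially on all but finitely many blocks, and it
    is strictly increasing beyond, so together the \<open>h i\<close> separate heights\<close>
  define h :: "nat \<Rightarrow> real \<Rightarrow> real" where "h i t = max 0 (t - 1 / Suc i)" for i t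
  define \<phi> where "\<phi> w = shear (word_shift h w)" for w
  have act: "action_by_homeos ?G \<phi>"
    unfolding \<phi>_def[abs_def]
    by (rule shear_action) (auto simp: h_def[abs_def] intro!: continuous_intros)
  moreover have "action_sensitive ?G \<phi> ?d"
    unfolding action_sensitive_def
  proof (intro exI[of _ "1/4 :: real"] conjI allI impI)
    fix P :: torus and r :: real assume "r > 0"
    \<comment> \<open>any \<open>h i\<close> that is positive at the larger height separates\<close>
    have sep: "\<exists>i\<in>UNIV. 0 < h i t - h i s \<and> h i t - h i s \<le> 1 / 2"
      if "0 \<le> s" "s < t" "t \<le> 1 / 2" for s t
    proof -
      have "0 < t" using that by simp
      then obtain i where "1 / Suc i < t"
        using reals_Archimedean[of t] by (auto simp: inverse_eq_divide)
      moreover have "0 < 1 / real (Suc i)" by simp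
      ultimately show ?thesis using that unfolding h_def by (intro bexI[of _ i]) (linarith, simp)
    qed
    obtain Q w where "dist P Q < r" "w \<in> carrier ?G"
      "1 / 4 \<le> dist (shear (word_shift h w) P) (shear (word_shift h w) Q)"
      by (rule shear_action_expands[OF sep \<open>r > 0\<close>])
    then show "\<exists>Q. ennreal (dist P Q) < ennreal r \<and>
        (\<exists>g\<in>carrier ?G. ennreal (1 / 4) \<le> ennreal (dist (\<phi> g P) (\<phi> g Q)))"
      by (auto simp: \<phi>_def ennreal_less_iff intro!: ennreal_leI)
  qed simp
  moreover have "\<exists>\<G>. generates_pseudogroup (action_homeos ?G \<phi>) \<G> \<and> \<not> pseudogroup_sensitive \<G>"
  proof (rule action_pseudogroup_not_sensitive[OF act compatible_metric_dist,
        where B = "\<lambda>n. {P. height P < 1 / Suc n}"])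
    show "open {P. height P < 1 / Suc n}" for n
      by (intro open_Collect_less continuous_on_height continuous_on_const)
    have "height (abs_torus 0) = 0" by (simp add: height.abs_eq)
    then show "{P. height P < 1 / Suc n} \<noteq> {}" for n
      by (metis (mono_tags, lifting) empty_iff mem_Collect_eq of_nat_0_less_iff zero_less_Suc zero_less_divide_1_iff)
    show "\<phi> w P \<in> {P. height P < 1 / Suc n} \<longleftrightarrow> P \<in> {P. height P < 1 / Suc n}" for w P n
      by (simp add: \<phi>_def)
    fix w :: "(nat \<times> bool) list" and P :: torus
    have "{n. \<exists>Q\<in>UNIV \<inter> {P. height P < 1 / Suc n}. \<phi> w Q \<noteq> Q} \<subseteq> (\<Union>i\<in>fst ` set w. {..i})"
    proof
      fix n assume "n \<in> {n. \<exists>Q\<in>UNIV \<inter> {P. height P < 1 / Suc n}. \<phi> w Q \<noteq> Q}"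
      then obtain Q where Q: "height Q < 1 / Suc n" "\<phi> w Q \<noteq> Q" by blast
      then have "word_shift h w (height Q) \<noteq> 0" using shear_eq_self unfolding \<phi>_def by blast
      then obtain i where i: "i \<in> fst ` set w" "h i (height Q) \<noteq> 0"
        using word_shift_eq_0 by metis
      then have "1 / Suc i < 1 / Suc n" using Q(1) unfolding h_def by linarith
      then have "n < i" by (simp add: field_simps)
      then show "n \<in> (\<Union>i\<in>fst ` set w. {..i})" using i(1) by (intro UN_I[of i]) simp_all
    qed
    then have "finite {n. \<exists>Q\<in>UNIV \<inter> {P. height P < 1 / Suc n}. \<phi> w Q \<noteq> Q}"
      by (rule finite_subset) simp
    then show "\<exists>U. open U \<and> P \<in> U \<and> finite {n. \<exists>Q\<in>U \<inter> {P. height P < 1 / Suc n}. \<phi> w Q \<noteq> Q}"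
      by blast
  qed
  ultimately show "\<exists>\<phi>. action_by_homeos ?G \<phi> \<and> action_sensitive ?G \<phi> ?d \<and>
      (\<exists>\<G>. generates_pseudogroup (action_homeos ?G \<phi>) \<G> \<and> \<not> pseudogroup_sensitive \<G>)"
    by blast
qed

end
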